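(* Let $\alpha$ be a non-lightlike curve in $E_1^3$ with curvature $\kappa$ and torsion $\tau$, and let $\beta$ be a Mannheim-direction curve of $\alpha$ with curvature $\overline\kappa$ and torsion $\overline\tau$, where $X=\overline T$ is the vector field of which $\beta$ is an integral curve. (i) If $\alpha$ is a timelike curve with $|\tau|>|\kappa|$ (respectively, spacelike curve of type 1), $X$ is timelike (respectively, spacelike) and $\beta$ is a timelike Mannheim-direction curve (respectively, spacelike curve of type 2) of $\alpha$, then $$\overline{\kappa}=\left|\tau\sinh\left(\int\kappa\,ds\right)\right|,\quad \overline{\tau}=-\tau\cosh\left(\int\kappa\,ds\right),\quad \kappa=\left|\frac{\overline{\kappa}^2}{\overline{\tau}^2-\overline{\kappa}^2}\left(\frac{\overline{\tau}}{\overline{\kappa}}\right)'\right|,\quad |\tau|=\sqrt{\overline{\tau}^2-\overline{\kappa}^2}.$$ (ii) If $\alpha$ is a timelike curve with $|\kappa|>|\tau|$ (respectively, spacelike curve of type 1), $X$ is spacelike (respectively, timelike) and $\beta$ is a Mannheim-direction spacelike curve of type 2 (respectively, timelike) of $\alpha$, then $$\overline{\kappa}=\left|\tau\cosh\left(\int\kappa\,ds\right)\right|,\quad \overline{\tau}=\tau\sinh\left(\int\kappa\,ds\right),\quad \kappa=\left|\frac{\overline{\kappa}^2}{\overline{\kappa}^2-\overline{\tau}^2}\left(\frac{\overline{\tau}}{\overline{\kappa}}\right)'\right|,\quad |\tau|=\sqrt{\overline{\kappa}^2-\overline{\tau}^2}.$$ (iii) If $\alpha$ is a spacelike curve of type 2,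 $X$ is spacelike and $\beta$ is a Mannheim-direction spacelike curve of type 1 of $\alpha$, then $$\overline{\kappa}=\left|\tau\sin\left(\int\kappa\,ds\right)\right|,\quad \overline{\tau}=\tau\cos\left(\int\kappa\,ds\right),\quad \kappa=\left|\frac{\overline{\kappa}^2}{\overline{\kappa}^2+\overline{\tau}^2}\left(\frac{\overline{\tau}}{\overline{\kappa}}\right)'\right|,\quad |\tau|=\sqrt{\overline{\kappa}^2+\overline{\tau}^2}.$$
   Context: $E_1^3$ is $\mathbb{R}^3$ with the metric $\langle x,y\rangle=-x_1y_1+x_2y_2+x_3y_3$ and the Lorentz vector product $x\times y=(x_2y_3-x_3y_2,\ x_1y_3-x_3y_1,\ x_2y_1-x_1y_2)$. A vector $x$ is spacelike if $\langle x,x\rangle>0$ or $x=0$, timelike if $\langle x,x\rangle<0$, lightlike if $\langle x,x\rangle=0$ and $x\ne0$. A curve is timelike (spacelike) if all its velocity vectors are; non-lightlike means timelike or spacelike; unit speed means $|\langle\alpha',\alpha'\rangle|=1$. All curves are unit speed Frenet curves, as differentiable as needed. A unit speed non-lightlike curve $\alpha(s)$ has Frenet frame $\{T,N,B\}$ (orthonormal, non-lightlike vectors, $T=\alpha'$), curvature $\kappa$ and torsion $\tau$ with $T'=\kappa N,\ N'=\varepsilon_B\kappa T+\tau B,\ B'=\varepsilon_T\tau N$, where $\varepsilon_Y=\langle Y,Y\rangle=\pm1$ and $\varepsilon_B=-\varepsilon_T\varepsilon_N$; the frame satisfies $B=\varepsilon_T\varepsilon_N T\times N$, $N=\varepsilon_B\varepsilon_T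 B\times T$, $T=\varepsilon_N\varepsilon_B N\times B$. It is a Frenet curve if $\kappa\neq0$. A spacelike curve is of type 1 if $N$ is timelike (and $T,B$ spacelike), of type 2 if $B$ is timelike (and $T,N$ spacelike). Let $X=uT+vN+wB$ with $u,v,w$ differentiable and $\varepsilon_Tu^2+\varepsilon_Nv^2+\varepsilon_Bw^2=\pm1$ (constant sign). An $X$-direction curve of $\alpha$ is a curve $\beta$ with tangent $\overline T=X$; $s$ is also arc-length for $\beta$. The Frenet frame, curvature and torsion of $\beta$ are $\{\overline T,\overline N,\overline B\},\overline\kappa,\overline\tau$, with $\overline\kappa\ne0$. $\beta$ is a Mannheim-direction curve of $\alpha$ if it is an $X$-direction curve of $\alpha$ and a Mannheim curve of $\alpha$ with $\alpha$ its Mannheim partner curve (i.e. $\overline N=B$); explicitly, $X$ is: $-\cosh(\int\kappa ds)T+\sinh(\int\kappa ds)N$ if $\alpha$ is timelike (resp. spacelike of type 1) and $X$ timelike (resp. spacelike); $\sinh(\int\kappa ds)T-\cosh(\int\kappa ds)N$ if $\alpha$ is timelike (resp. spacelike of type 1) and $X$ spacelike (resp. timelike); $-\cos(\int\kappa ds)T+\sin(\int\kappa ds)N$ if $\alpha$ is spacelike of type 2 and $X$ spacelike. Here $\int\kappa\,ds$ is an antiderivative of $\kappa$, the same one in $X$ and in the formulas of the claim.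
   Formalization: For spacelike α of type 1 the sign of the torsion of β is corrected: it is +τ cosh(∫κ ds) in (i) and −τ sinh(∫κ ds) in (ii), as the printed signs fail there; both curvatures are taken positive, and the normal of β is ±B. *)

theory Defs
  imports "HOL-Analysis.Analysis"
begin

definition lorentz_inner :: "real^3 \<Rightarrow> real^3 \<Rightarrow> real" where
  "lorentz_inner x y = - (x$1 * y$1) + x$2 * y$2 + x$3 * y$3"

definition lorentz_cross :: "real^3 \<Rightarrow> real^3 \<Rightarrow> real^3" where
  "lorentz_cross x y =
     vector [x$2 * y$3 - x$3 * y$2, x$1 * y$3 - x$3 * y$1, x$2 * y$1 - x$1 * y$2]"

definition spacelike :: "real^3 \<Rightarrow> bool" where
  "spacelike x \<longleftrightarrow> lorentz_inner x x > 0 \<or> x = 0"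

definition timelike :: "real^3 \<Rightarrow> bool" where
  "timelike x \<longleftrightarrow> lorentz_inner x x < 0"

text \<open>Curves and vector fields along them are functions of the arc-length parameter on an
  interval \<open>I\<close>, which the main statement takes to be open.\<close>

definition timelike_field :: "real set \<Rightarrow> (real \<Rightarrow> real^3) \<Rightarrow> bool" where
  "timelike_field I X \<longleftrightarrow> (\<forall>s\<in>I. timelike (X s))"

definition spacelike_field :: "real set \<Rightarrow> (real \<Rightarrow> real^3) \<Rightarrow> bool" where
  "spacelike_field I X \<longleftrightarrow> (\<forall>s\<in>I. spacelike (X s))"

definition timelike_curve :: "real set \<Rightarrow> (real \<Rightarrow> real^3) \<Rightarrow> bool" where
  "timelike_curve I \<alpha> \<longleftrightarrow> timelike_field I (\<lambda>s. vector_derivative \<alpha> (at s))"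

definition spacelike_curve :: "real set \<Rightarrow> (real \<Rightarrow> real^3) \<Rightarrow> bool" where
  "spacelike_curve I \<alpha> \<longleftrightarrow> spacelike_field I (\<lambda>s. vector_derivative \<alpha> (at s))"

definition nonlightlike_curve :: "real set \<Rightarrow> (real \<Rightarrow> real^3) \<Rightarrow> bool" where
  "nonlightlike_curve I \<alpha> \<longleftrightarrow> timelike_curve I \<alpha> \<or> spacelike_curve I \<alpha>"

record frenet_apparatus =
  tangent :: "real \<Rightarrow> real^3"
  normal :: "real \<Rightarrow> real^3"
  binormal :: "real \<Rightarrow> real^3"
  curvature :: "real \<Rightarrow> real"
  torsion :: "real \<Rightarrow> real"

definition sign_T :: "frenet_apparatus \<Rightarrow> real \<Rightarrow> real" where
  "sign_T F s = lorentz_inner (tangent F s) (tangent F s)"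

definition sign_N :: "frenet_apparatus \<Rightarrow> real \<Rightarrow> real" where
  "sign_N F s = lorentz_inner (normal F s) (normal F s)"

definition sign_B :: "frenet_apparatus \<Rightarrow> real \<Rightarrow> real" where
  "sign_B F s = lorentz_inner (binormal F s) (binormal F s)"

text \<open>The curvature of a Frenet curve is taken positive (it is the Lorentzian length of
  \<open>T'\<close>), so the equations below determine \<open>F\<close> on \<open>I\<close> from \<open>\<alpha>\<close>. In particular the
  orientation condition on \<open>B\<close> fixes the sign of the torsion; with \<open>sign_B = - sign_T * sign_N\<close>
  it implies \<open>N = sign_B * sign_T * (B \<times> T)\<close> and \<open>T = sign_N * sign_B * (N \<times> B)\<close>.\<close>

definition frenet_curve :: "real set \<Rightarrow> (real \<Rightarrow> real^3) \<Rightarrow> frenet_apparatus \<Rightarrow> bool" where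
  "frenet_curve I \<alpha> F \<longleftrightarrow> (\<forall>s\<in>I.
     (\<alpha> has_vector_derivative tangent F s) (at s) \<and>
     \<bar>sign_T F s\<bar> = 1 \<and> \<bar>sign_N F s\<bar> = 1 \<and> \<bar>sign_B F s\<bar> = 1 \<and>
     lorentz_inner (tangent F s) (normal F s) = 0 \<and>
     lorentz_inner (tangent F s) (binormal F s) = 0 \<and>
     lorentz_inner (normal F s) (binormal F s) = 0 \<and>
     sign_B F s = - sign_T F s * sign_N F s \<and>
     binormal F s = (sign_T F s * sign_N F s) *\<^sub>R lorentz_cross (tangent F s) (normal F s) \<and>
     curvature F s > 0 \<and>
     (tangent F has_vector_derivative curvature F s *\<^sub>R normal F s) (at s) \<and>
     (normal F has_vector_derivative
        (sign_B F s * curvature F s) *\<^sub>R tangent F s + torsion F s *\<^sub>R binormal F s) (at s) \<and>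
     (binormal F has_vector_derivative (sign_T F s * torsion F s) *\<^sub>R normal F s) (at s))"

definition spacelike_type1 :: "real set \<Rightarrow> (real \<Rightarrow> real^3) \<Rightarrow> frenet_apparatus \<Rightarrow> bool" where
  "spacelike_type1 I \<alpha> F \<longleftrightarrow> spacelike_curve I \<alpha> \<and> spacelike_field I (tangent F) \<and>
     timelike_field I (normal F) \<and> spacelike_field I (binormal F)"

definition spacelike_type2 :: "real set \<Rightarrow> (real \<Rightarrow> real^3) \<Rightarrow> frenet_apparatus \<Rightarrow> bool" where
  "spacelike_type2 I \<alpha> F \<longleftrightarrow> spacelike_curve I \<alpha> \<and> spacelike_field I (tangent F) \<and>
     spacelike_field I (normal F) \<and> timelike_field I (binormal F)"

text \<open>\<open>F\<close> is the Frenet apparatus of the base curve, \<open>G\<close> that of its direction curve \<open>\<beta>\<close>.\<close>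

definition direction_curve ::
  "real set \<Rightarrow> frenet_apparatus \<Rightarrow> (real \<Rightarrow> real^3) \<Rightarrow> (real \<Rightarrow> real^3) \<Rightarrow> frenet_apparatus \<Rightarrow> bool"
  where
  "direction_curve I F X \<beta> G \<longleftrightarrow>
     (\<exists>u v w :: real \<Rightarrow> real.
        u differentiable_on I \<and> v differentiable_on I \<and> w differentiable_on I \<and>
        (\<forall>s\<in>I. X s = u s *\<^sub>R tangent F s + v s *\<^sub>R normal F s + w s *\<^sub>R binormal F s) \<and>
        (\<exists>e\<in>{1, -1}. \<forall>s\<in>I.
           sign_T F s * (u s)\<^sup>2 + sign_N F s * (v s)\<^sup>2 + sign_B F s * (w s)\<^sup>2 = e)) \<and>
     frenet_curve I \<beta> G \<and> (\<forall>s\<in>I. tangent G s = X s)"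

text \<open>The Mannheim condition is the coincidence of the principal normal line of \<open>\<beta>\<close> with the
  binormal line of \<open>\<alpha>\<close>. As both curvatures are positive, the unit vectors spanning these lines
  agree only up to sign.\<close>

definition mannheim_curve_of :: "real set \<Rightarrow> frenet_apparatus \<Rightarrow> frenet_apparatus \<Rightarrow> bool" where
  "mannheim_curve_of I F G \<longleftrightarrow>
     (\<forall>s\<in>I. normal G s = binormal F s \<or> normal G s = - binormal F s)"

text \<open>\<open>\<theta>\<close> is the antiderivative of the curvature of \<open>\<alpha>\<close> in terms of which \<open>X\<close> is written.\<close>

definition mannheim_direction_curve ::
  "real set \<Rightarrow> (real \<Rightarrow> real^3) \<Rightarrow> frenet_apparatus \<Rightarrow> (real \<Rightarrow> real) \<Rightarrow> (real \<Rightarrow> real^3) \<Rightarrow>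
   (real \<Rightarrow> real^3) \<Rightarrow> frenet_apparatus \<Rightarrow> bool" where
  "mannheim_direction_curve I \<alpha> F \<theta> X \<beta> G \<longleftrightarrow>
     direction_curve I F X \<beta> G \<and> mannheim_curve_of I F G \<and>
     (timelike_curve I \<alpha> \<and> timelike_field I X \<or> spacelike_type1 I \<alpha> F \<and> spacelike_field I X \<longrightarrow>
        (\<forall>s\<in>I. X s = - cosh (\<theta> s) *\<^sub>R tangent F s + sinh (\<theta> s) *\<^sub>R normal F s)) \<and>
     (timelike_curve I \<alpha> \<and> spacelike_field I X \<or> spacelike_type1 I \<alpha> F \<and> timelike_field I X \<longrightarrow>
        (\<forall>s\<in>I. X s = sinh (\<theta> s) *\<^sub>R tangent F s - cosh (\<theta> s) *\<^sub>R normal F s)) \<and>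
     (spacelike_type2 I \<alpha> F \<and> spacelike_field I X \<longrightarrow>
        (\<forall>s\<in>I. X s = - cos (\<theta> s) *\<^sub>R tangent F s + sin (\<theta> s) *\<^sub>R normal F s))"

end

theory Submission
  imports Defs
begin

text \<open>Write \<open>X = a T + b N\<close>. Since \<open>X' = \<kappa>\<^sub>\<beta> N\<^sub>\<beta>\<close> and \<open>N\<^sub>\<beta> = \<sigma> B\<close> with \<open>\<sigma> = \<plusminus>1\<close>, comparing
  \<open>B\<close>-components gives \<open>\<kappa>\<^sub>\<beta> = \<sigma> b \<tau>\<close>. Comparing \<open>N\<^sub>\<beta>' = \<epsilon>\<^sub>B\<^sub>\<beta> \<kappa>\<^sub>\<beta> X + \<tau>\<^sub>\<beta> B\<^sub>\<beta>\<close> with \<open>\<sigma> B'\<close> gives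
  \<open>\<tau>\<^sub>\<beta> = - \<epsilon>\<^sub>T a \<tau>\<close>. No continuity of \<open>\<tau>\<close> is available, but \<open>\<sigma>\<close> is locally constant because \<open>N\<^sub>\<beta>\<close> and
  \<open>B\<close> are continuous. Hence \<open>\<tau>\<^sub>\<beta> / \<kappa>\<^sub>\<beta>\<close> is locally a constant sign times \<open>a / b\<close>, whose derivative
  is \<open>\<plusminus>\<kappa> / b\<^sup>2\<close> for each of the five fields \<open>X\<close>.\<close>

section \<open>Algebra of the Lorentz inner and vector products\<close>

lemma lorentz_inner_linear:
  "lorentz_inner (x + y) z = lorentz_inner x z + lorentz_inner y z"
  "lorentz_inner x (y + z) = lorentz_inner x y + lorentz_inner x z"
  "lorentz_inner (c *\<^sub>R x) y = c * lorentz_inner x y"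
  "lorentz_inner x (c *\<^sub>R y) = c * lorentz_inner x y"
  by (simp_all add: lorentz_inner_def algebra_simps)

lemma lorentz_cross_linear:
  "lorentz_cross (x + y) z = lorentz_cross x z + lorentz_cross y z"
  "lorentz_cross (c *\<^sub>R x) y = c *\<^sub>R lorentz_cross x y"
  "lorentz_cross x (c *\<^sub>R y) = c *\<^sub>R lorentz_cross x y"
  by (simp_all add: lorentz_cross_def vec_eq_iff forall_3 algebra_simps)

lemma lorentz_triple_left_self: "lorentz_inner x (lorentz_cross x y) = 0"
  by (simp add: lorentz_inner_def lorentz_cross_def algebra_simps)

text \<open>The triple product is minus the determinant with rows \<open>x\<close>,
  \<open>y\<close>, \<open>z\<close>, and exchanging two rows changes its sign.\<close>

lemma lorentz_triple_swap:
  "lorentz_inner x (lorentz_cross y z) = - lorentz_inner z (lorentz_cross y x)"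
  by (simp add: lorentz_inner_def lorentz_cross_def algebra_simps)

lemma abs_eq_1_mult_self: "\<bar>x\<bar> = 1 \<Longrightarrow> x * x = (1 :: real)"
  by (metis abs_mult_self_eq mult_1)

section \<open>Frenet frames and the local sign in the Mannheim condition\<close>

lemma frenet_curveD:
  assumes "frenet_curve I \<alpha> F" "s \<in> I"
  shows "\<bar>sign_T F s\<bar> = 1" "\<bar>sign_N F s\<bar> = 1" "\<bar>sign_B F s\<bar> = 1"
    "lorentz_inner (tangent F s) (normal F s) = 0"
    "lorentz_inner (tangent F s) (binormal F s) = 0"
    "lorentz_inner (normal F s) (binormal F s) = 0"
    "sign_B F s = - sign_T F s * sign_N F s"
    "binormal F s = (sign_T F s * sign_N F s) *\<^sub>R lorentz_cross (tangent F s) (normal F s)"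
    "curvature F s > 0"
    "(\<alpha> has_vector_derivative tangent F s) (at s)"
    "(tangent F has_vector_derivative curvature F s *\<^sub>R normal F s) (at s)"
    "(normal F has_vector_derivative
        (sign_B F s * curvature F s) *\<^sub>R tangent F s + torsion F s *\<^sub>R binormal F s) (at s)"
    "(binormal F has_vector_derivative (sign_T F s * torsion F s) *\<^sub>R normal F s) (at s)"
  using assms unfolding frenet_curve_def by blast+

lemma frenet_binormal_nonzero:
  assumes "frenet_curve I \<alpha> F" "s \<in> I"
  shows "binormal F s \<noteq> 0"
  using frenet_curveD(3)[OF assms] by (auto simp: sign_B_def lorentz_inner_def)

text \<open>The relation \<open>sign_B = - sign_T * sign_N\<close> absorbs the signs in the
  orientation formula for the binormal, so the value is the same for all causal types. It later
  isolates the tangential coefficient of \<open>X\<close>.\<close>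

lemma frenet_triple_tangent_binormal:
  assumes "frenet_curve I \<alpha> F" "s \<in> I"
  shows "lorentz_inner (normal F s) (lorentz_cross (tangent F s) (binormal F s)) = 1"
proof -
  note D = frenet_curveD[OF assms]
  let ?t = "lorentz_inner (binormal F s) (lorentz_cross (tangent F s) (normal F s))"
  have "sign_B F s = (sign_T F s * sign_N F s) * ?t"
    using D(8) unfolding sign_B_def by (metis lorentz_inner_linear(4))
  moreover have "sign_T F s * sign_N F s \<noteq> 0"
    using D(1,2) by auto
  ultimately have "?t = -1"
    using D(7) by (metis mult_cancel_left mult_minus1_right mult_minus_left)
  then show ?thesis
    using lorentz_triple_swap[of "normal F s"] by simp
qed

text \<open>The Mannheim condition allows a different sign at each point; differentiating it at
  \<open>s\<close> requires one sign on a whole neighbourhood.\<close>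

lemma mannheim_normal_locally_eq:
  assumes "open I" "frenet_curve I \<alpha> F" "frenet_curve I \<beta> G"
    and "mannheim_curve_of I F G" "s \<in> I"
  obtains \<sigma> :: real where "\<bar>\<sigma>\<bar> = 1" "\<forall>\<^sub>F r in nhds s. normal G r = \<sigma> *\<^sub>R binormal F r"
proof -
  obtain \<sigma> :: real where \<sigma>: "\<bar>\<sigma>\<bar> = 1" "\<sigma> = 1 \<or> \<sigma> = -1" "normal G s = \<sigma> *\<^sub>R binormal F s"
    using assms(4,5) unfolding mannheim_curve_of_def
    by (metis abs_minus_cancel abs_one scaleR_minus1_left scaleR_one)
  \<comment> \<open>With the opposite sign at \<open>r\<close> this sum would be 0, so its being
    nonzero near \<open>s\<close> rules that sign out.\<close>
  let ?f = "\<lambda>r. normal G r + \<sigma> *\<^sub>R binormal F r"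
  have "?f s = (2 * \<sigma>) *\<^sub>R binormal F s"
    using \<sigma>(3) by (simp add: scaleR_2 flip: scaleR_scaleR)
  then have "?f s \<noteq> 0"
    using \<sigma>(1) frenet_binormal_nonzero[OF assms(2,5)] by auto
  moreover have "isCont ?f s"
    using frenet_curveD(13)[OF assms(2,5), THEN has_vector_derivative_continuous]
      frenet_curveD(12)[OF assms(3,5), THEN has_vector_derivative_continuous]
    by (intro continuous_intros)
  ultimately have "\<forall>\<^sub>F r in nhds s. ?f r \<noteq> 0"
    unfolding eventually_nhds_conv_at by (auto dest: isContD intro: tendsto_imp_eventually_ne)
  moreover have "\<forall>\<^sub>F r in nhds s. r \<in> I"
    using assms(1,5) by (simp add: eventually_nhds_in_open)
  ultimately have "\<forall>\<^sub>F r in nhds s. normal G r = \<sigma> *\<^sub>R binormal F r"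
    by eventually_elim (use \<sigma>(2) assms(4) in \<open>auto simp: mannheim_curve_of_def\<close>)
  with \<sigma>(1) show thesis by (rule that)
qed

section \<open>Comparison of derivatives: curvature and torsion of the direction curve\<close>

lemma has_vector_derivative_unique_nhds:
  assumes "(f has_vector_derivative f') (at s)" "(g has_vector_derivative g') (at s)"
    and "\<forall>\<^sub>F r in nhds s. f r = g r"
  shows "f' = g'"
proof -
  have "(g has_vector_derivative f') (at s)"
    using assms(1,3) eventually_nhds_x_imp_x[OF assms(3)]
      has_vector_derivative_cong_ev[where f = f and g = g and S = UNIV and x = s] by simp
  then show ?thesis
    using assms(2) by (rule vector_derivative_unique_at)
qed

lemma direction_curve_curvature_torsion:
  assumes I: "open I" "s \<in> I" and F: "frenet_curve I \<alpha> F" and G: "frenet_curve I \<beta> G"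
    and \<sigma>: "\<bar>\<sigma>\<bar> = 1" "\<forall>\<^sub>F r in nhds s. normal G r = \<sigma> *\<^sub>R binormal F r"
    and X: "\<forall>r\<in>I. tangent G r = a r *\<^sub>R tangent F r + b r *\<^sub>R normal F r"
    and a: "(a has_real_derivative a') (at s)" and b: "(b has_real_derivative b') (at s)"
  shows "curvature G s = \<sigma> * (b s * torsion F s)"
    and "torsion G s = - sign_T F s * (torsion F s * a s)"
proof -
  note F3 = frenet_triple_tangent_binormal[OF F I(2)]
  note F = frenet_curveD[OF F I(2)]
  note G = frenet_curveD[OF G I(2)]
  have nG: "normal G s = \<sigma> *\<^sub>R binormal F s"
    using \<sigma>(2) by (rule eventually_nhds_x_imp_x)
  have \<sigma>2: "\<sigma> * \<sigma> = 1"
    using \<sigma>(1) by (rule abs_eq_1_mult_self)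
  have B: "sign_B F s \<noteq> 0"
    using F(3) by auto
  have "\<forall>\<^sub>F r in nhds s. tangent G r = a r *\<^sub>R tangent F r + b r *\<^sub>R normal F r"
    using X I by (auto simp: eventually_nhds)
  \<comment> \<open>Pairing with the binormal of \<alpha> kills every term along the tangent and the
    normal, including those with \<open>a'\<close> and \<open>b'\<close>; only the torsion part of
    the derivative of the normal is left.\<close>
  from has_vector_derivative_unique_nhds[OF G(11) _ this,
      OF has_vector_derivative_add[OF has_vector_derivative_scaleR[OF a F(11)]
        has_vector_derivative_scaleR[OF b F(12)]]]
  have "lorentz_inner (curvature G s *\<^sub>R normal G s) (binormal F s) =
      b s * torsion F s * sign_B F s"
    using F(4,5,6) by (simp add: lorentz_inner_linear sign_B_def)
  then have "\<sigma> * curvature G s = b s * torsion F s"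
    using B by (simp add: nG lorentz_inner_linear mult.commute flip: sign_B_def)
  then show "curvature G s = \<sigma> * (b s * torsion F s)"
    using \<sigma>2 by (metis mult.assoc mult_1)
  have "((\<lambda>r. \<sigma> *\<^sub>R binormal F r) has_vector_derivative
      \<sigma> *\<^sub>R ((sign_T F s * torsion F s) *\<^sub>R normal F s)) (at s)"
    using has_vector_derivative_scaleR[OF DERIV_const F(13), of \<sigma>] by simp
  \<comment> \<open>Pairing with the binormal of \<beta> removes the tangential term on the
    left.\<close>
  from has_vector_derivative_unique_nhds[OF G(12) this \<sigma>(2)]
  have "lorentz_inner ((sign_B G s * curvature G s) *\<^sub>R tangent G s + torsion G s *\<^sub>R binormal G s)
        (binormal G s) =
      lorentz_inner (\<sigma> *\<^sub>R ((sign_T F s * torsion F s) *\<^sub>R normal F s)) (binormal G s)"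
    by simp
  then have *: "torsion G s * sign_B G s =
      \<sigma> * sign_T F s * torsion F s * lorentz_inner (normal F s) (binormal G s)"
    using G(5) by (simp add: lorentz_inner_linear sign_B_def)
  \<comment> \<open>When the tangent of \<beta> is expanded, the cross product of the normal and
    binormal of \<alpha> is orthogonal to that normal, and the other term contributes
    \<open>\<sigma> * a s\<close> by the triple product \<open>F3\<close>. The sign factor in front
    is \<open>- sign_B G s\<close>.\<close>
  have "binormal G s =
      (sign_T G s * sign_N G s) *\<^sub>R lorentz_cross (tangent G s) (\<sigma> *\<^sub>R binormal F s)"
    using G(8) nG by simp
  then have "lorentz_inner (normal F s) (binormal G s) = - sign_B G s * (\<sigma> * a s)"
    using X I(2) G(7) F3
    by (simp add: lorentz_inner_linear lorentz_cross_linear lorentz_triple_left_self)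
  \<comment> \<open>One \<sigma> comes from the normal of \<beta> and one from its binormal; they
    cancel, so the torsion, unlike the curvature, carries no unknown sign.\<close>
  with * have "torsion G s * sign_B G s =
      - sign_T F s * (torsion F s * a s) * (\<sigma> * \<sigma>) * sign_B G s"
    by (simp add: mult_ac)
  then show "torsion G s = - sign_T F s * (torsion F s * a s)"
    using \<sigma>2 G(3) by (metis abs_0 mult.right_neutral mult_right_cancel zero_neq_one)
qed

text \<open>The expression in \<open>W\<close> is the numerator of the derivative of
  \<open>a / b\<close>. \<open>D\<close> is left open so that each causal case can insert its own
  expression of the squared torsion through the curvature and torsion of \<beta>.\<close>

lemma mannheim_direction_curvatures:
  assumes I: "open I" and F: "frenet_curve I \<alpha> F" and G: "frenet_curve I \<beta> G"
    and M: "mannheim_curve_of I F G"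
    and e: "\<bar>e\<bar> = 1" "\<forall>r\<in>I. sign_T F r = e"
    and X: "\<forall>r\<in>I. tangent G r = a r *\<^sub>R tangent F r + b r *\<^sub>R normal F r"
    and a: "\<forall>r\<in>I. (a has_real_derivative a' r) (at r)"
    and b: "\<forall>r\<in>I. (b has_real_derivative b' r) (at r)"
    and W: "\<forall>r\<in>I. \<bar>a' r * b r - a r * b' r\<bar> = curvature F r"
    and s: "s \<in> I"
  shows "curvature G s = \<bar>torsion F s * b s\<bar>"
    and "torsion G s = - e * torsion F s * a s"
    and "D = (torsion F s)\<^sup>2 \<Longrightarrow>
      curvature F s = \<bar>(curvature G s)\<^sup>2 / D * deriv (\<lambda>r. torsion G r / curvature G r) s\<bar>"
proof -
  \<comment> \<open>Stated at a general point \<open>r\<close>, since differentiating the quotient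
    at \<open>s\<close> needs these formulas around \<open>s\<close> with the same \<sigma>.\<close>
  have kt: "curvature G r = \<sigma> * (b r * torsion F r)" "torsion G r = - e * torsion F r * a r"
    if "r \<in> I" "\<bar>\<sigma>\<bar> = 1" "\<forall>\<^sub>F r in nhds r. normal G r = \<sigma> *\<^sub>R binormal F r" for r \<sigma>
    using direction_curve_curvature_torsion[OF I that(1) F G that(2,3) X] a b e(2) that(1)
    by (metis mult.assoc)+
  obtain \<sigma> where \<sigma>: "\<bar>\<sigma>\<bar> = 1" "\<forall>\<^sub>F r in nhds s. normal G r = \<sigma> *\<^sub>R binormal F r"
    using mannheim_normal_locally_eq[OF I F G M s] by blast
  have kpos: "curvature G r > 0" if "r \<in> I" for r
    using frenet_curveD(9)[OF G that] .
  show k: "curvature G s = \<bar>torsion F s * b s\<bar>"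
    using kt(1)[OF s \<sigma>] kpos[OF s] \<sigma>(1) by (metis abs_mult abs_of_pos mult.commute mult_1)
  show "torsion G s = - e * torsion F s * a s"
    by (rule kt(2)[OF s \<sigma>])
  \<comment> \<open>Positivity of the curvature of \<beta> is what justifies the divisions
    below.\<close>
  have nz: "torsion F s \<noteq> 0" "b s \<noteq> 0"
    using k kpos[OF s] by auto
  \<comment> \<open>The torsion of \<alpha> cancels, leaving a quotient of differentiable
    functions.\<close>
  have "\<forall>\<^sub>F r in nhds s. torsion G r / curvature G r = (- e / \<sigma>) * (a r / b r)"
  proof -
    have "\<forall>\<^sub>F r in nhds s. \<forall>\<^sub>F r in nhds r. normal G r = \<sigma> *\<^sub>R binormal F r"
      using \<sigma>(2) by (simp add: eventually_eventually)
    moreover have "\<forall>\<^sub>F r in nhds s. r \<in> I"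
      using I s by (simp add: eventually_nhds_in_open)
    ultimately show ?thesis
    proof eventually_elim
      case (elim r)
      then have "curvature G r = \<sigma> * (b r * torsion F r)" "torsion G r = - e * torsion F r * a r"
        using kt \<sigma>(1) by blast+
      moreover from this have "torsion F r \<noteq> 0"
        using kpos[OF elim(2)] by auto
      ultimately show ?case by simp
    qed
  qed
  then have "deriv (\<lambda>r. torsion G r / curvature G r) s = deriv (\<lambda>r. (- e / \<sigma>) * (a r / b r)) s"
    by (rule deriv_cong_ev) simp
  also have "\<dots> = (- e / \<sigma>) * ((a' s * b s - a s * b' s) / (b s * b s))"
    using a b s nz(2) by (intro DERIV_imp_deriv DERIV_cmult DERIV_divide) auto
  finally have d: "\<bar>deriv (\<lambda>r. torsion G r / curvature G r) s\<bar> = curvature F s / (b s)\<^sup>2"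
    using e(1) \<sigma>(1) W s by (simp add: abs_mult abs_divide power2_eq_square)
  show "curvature F s = \<bar>(curvature G s)\<^sup>2 / D * deriv (\<lambda>r. torsion G r / curvature G r) s\<bar>"
    if "D = (torsion F s)\<^sup>2"
    \<comment> \<open>Dividing the squared curvature of \<beta> by \<open>D\<close> leaves
      \<open>(b s)\<^sup>2\<close>, which cancels the denominator in \<open>d\<close>.\<close>
    using nz by (simp add: abs_mult abs_divide that d) (simp add: k power_mult_distrib)
qed

section \<open>Causal types and fields \<open>X\<close> given by an angle function\<close>

lemma timelike_curve_sign_T:
  assumes "frenet_curve I \<alpha> F" "timelike_curve I \<alpha>" "s \<in> I"
  shows "sign_T F s = -1"
proof -
  have "vector_derivative \<alpha> (at s) = tangent F s"
    using frenet_curveD(10)[OF assms(1,3)] by (rule vector_derivative_at)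
  then have "sign_T F s < 0"
    using assms(2,3) by (auto simp: timelike_curve_def timelike_field_def timelike_def sign_T_def)
  then show ?thesis
    using frenet_curveD(1)[OF assms(1,3)] by simp
qed

lemma spacelike_tangent_sign_T:
  assumes "frenet_curve I \<alpha> F" "spacelike_field I (tangent F)" "s \<in> I"
  shows "sign_T F s = 1"
proof -
  \<comment> \<open>Only a weak inequality, as the zero vector counts as spacelike; the unit length
    of the tangent then excludes 0.\<close>
  have "sign_T F s \<ge> 0"
    using assms(2,3) by (force simp: spacelike_field_def spacelike_def sign_T_def lorentz_inner_def)
  then show ?thesis
    using frenet_curveD(1)[OF assms(1,3)] by simp
qed

text \<open>By the chain rule both coefficients of \<open>X\<close> acquire the factor
  \<open>curvature F\<close>. Hence the numerator condition reduces to an identity \<open>W\<close>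
  between \<open>p\<close> and \<open>q\<close> alone, which is the Pythagorean identity in its
  hyperbolic or circular form.\<close>

lemma mannheim_direction_angle:
  assumes I: "open I" and F: "frenet_curve I \<alpha> F" and G: "frenet_curve I \<beta> G"
    and M: "mannheim_curve_of I F G"
    and \<theta>: "\<forall>r\<in>I. (\<theta> has_real_derivative curvature F r) (at r)"
    and e: "\<bar>e\<bar> = 1" "\<forall>r\<in>I. sign_T F r = e"
    and X: "\<forall>r\<in>I. tangent G r = p (\<theta> r) *\<^sub>R tangent F r + q (\<theta> r) *\<^sub>R normal F r"
    and p: "\<And>x. (p has_real_derivative p' x) (at x)"
    and q: "\<And>x. (q has_real_derivative q' x) (at x)"
    and W: "\<And>x. \<bar>p' x * q x - p x * q' x\<bar> = 1"
    and s: "s \<in> I"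
  shows "curvature G s = \<bar>torsion F s * q (\<theta> s)\<bar>"
    and "torsion G s = - e * torsion F s * p (\<theta> s)"
    and "D = (torsion F s)\<^sup>2 \<Longrightarrow>
      curvature F s = \<bar>(curvature G s)\<^sup>2 / D * deriv (\<lambda>r. torsion G r / curvature G r) s\<bar>"
proof -
  have a: "\<forall>r\<in>I. ((\<lambda>r. p (\<theta> r)) has_real_derivative p' (\<theta> r) * curvature F r) (at r)"
    and b: "\<forall>r\<in>I. ((\<lambda>r. q (\<theta> r)) has_real_derivative q' (\<theta> r) * curvature F r) (at r)"
    using \<theta> p q by (auto intro: DERIV_chain2)
  have "\<forall>r\<in>I. \<bar>p' (\<theta> r) * curvature F r * q (\<theta> r) - p (\<theta> r) * (q' (\<theta> r) * curvature F r)\<bar> =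
      curvature F r"
  proof
    fix r assume "r \<in> I"
    have "p' (\<theta> r) * curvature F r * q (\<theta> r) - p (\<theta> r) * (q' (\<theta> r) * curvature F r) =
        curvature F r * (p' (\<theta> r) * q (\<theta> r) - p (\<theta> r) * q' (\<theta> r))"
      by (simp add: algebra_simps)
    then show "\<bar>p' (\<theta> r) * curvature F r * q (\<theta> r) - p (\<theta> r) * (q' (\<theta> r) * curvature F r)\<bar> =
        curvature F r"
      using frenet_curveD(9)[OF F \<open>r \<in> I\<close>] by (simp add: abs_mult W)
  qed
  note C = mannheim_direction_curvatures[OF I F G M e X a b this s]
  show "curvature G s = \<bar>torsion F s * q (\<theta> s)\<bar>" "torsion G s = - e * torsion F s * p (\<theta> s)"
    "D = (torsion F s)\<^sup>2 \<Longrightarrow>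
      curvature F s = \<bar>(curvature G s)\<^sup>2 / D * deriv (\<lambda>r. torsion G r / curvature G r) s\<bar>"
    by (fact C)+
qed

text \<open>Timelike and type 1 curves form separate conjuncts: they share the coefficients of
  \<open>X\<close>, but the opposite values of \<open>sign_T\<close> give opposite signs to the
  torsion of \<beta>.\<close>

theorem theorem4p2:
  fixes I :: "real set" and \<alpha> \<beta> X :: "real \<Rightarrow> real^3" and \<theta> :: "real \<Rightarrow> real"
    and F G :: frenet_apparatus
  assumes "open I" and "is_interval I"
    and "nonlightlike_curve I \<alpha>" and "frenet_curve I \<alpha> F"
    and "\<forall>s\<in>I. (\<theta> has_real_derivative curvature F s) (at s)"
    and "mannheim_direction_curve I \<alpha> F \<theta> X \<beta> G"
  shows
    "(timelike_curve I \<alpha> \<and> (\<forall>s\<in>I. \<bar>torsion F s\<bar> > \<bar>curvature F s\<bar>) \<and>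
      timelike_field I X \<and> timelike_curve I \<beta> \<longrightarrow>
      (\<forall>s\<in>I.
        curvature G s = \<bar>torsion F s * sinh (\<theta> s)\<bar> \<and>
        torsion G s = - torsion F s * cosh (\<theta> s) \<and>
        curvature F s = \<bar>(curvature G s)\<^sup>2 / ((torsion G s)\<^sup>2 - (curvature G s)\<^sup>2) *
                          deriv (\<lambda>r. torsion G r / curvature G r) s\<bar> \<and>
        \<bar>torsion F s\<bar> = sqrt ((torsion G s)\<^sup>2 - (curvature G s)\<^sup>2)))
   \<and> (spacelike_type1 I \<alpha> F \<and> spacelike_field I X \<and> spacelike_type2 I \<beta> G \<longrightarrow>
      (\<forall>s\<in>I.
        curvature G s = \<bar>torsion F s * sinh (\<theta> s)\<bar> \<and>
        torsion G s = torsion F s * cosh (\<theta> s) \<and>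
        curvature F s = \<bar>(curvature G s)\<^sup>2 / ((torsion G s)\<^sup>2 - (curvature G s)\<^sup>2) *
                          deriv (\<lambda>r. torsion G r / curvature G r) s\<bar> \<and>
        \<bar>torsion F s\<bar> = sqrt ((torsion G s)\<^sup>2 - (curvature G s)\<^sup>2)))
   \<and> (timelike_curve I \<alpha> \<and> (\<forall>s\<in>I. \<bar>curvature F s\<bar> > \<bar>torsion F s\<bar>) \<and>
      spacelike_field I X \<and> spacelike_type2 I \<beta> G \<longrightarrow>
      (\<forall>s\<in>I.
        curvature G s = \<bar>torsion F s * cosh (\<theta> s)\<bar> \<and>
        torsion G s = torsion F s * sinh (\<theta> s) \<and>
        curvature F s = \<bar>(curvature G s)\<^sup>2 / ((curvature G s)\<^sup>2 - (torsion G s)\<^sup>2) *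
                          deriv (\<lambda>r. torsion G r / curvature G r) s\<bar> \<and>
        \<bar>torsion F s\<bar> = sqrt ((curvature G s)\<^sup>2 - (torsion G s)\<^sup>2)))
   \<and> (spacelike_type1 I \<alpha> F \<and> timelike_field I X \<and> timelike_curve I \<beta> \<longrightarrow>
      (\<forall>s\<in>I.
        curvature G s = \<bar>torsion F s * cosh (\<theta> s)\<bar> \<and>
        torsion G s = - torsion F s * sinh (\<theta> s) \<and>
        curvature F s = \<bar>(curvature G s)\<^sup>2 / ((curvature G s)\<^sup>2 - (torsion G s)\<^sup>2) *
                          deriv (\<lambda>r. torsion G r / curvature G r) s\<bar> \<and>
        \<bar>torsion F s\<bar> = sqrt ((curvature G s)\<^sup>2 - (torsion G s)\<^sup>2)))
   \<and> (spacelike_type2 I \<alpha> F \<and> spacelike_field I X \<and> spacelike_type1 I \<beta> G \<longrightarrow>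
      (\<forall>s\<in>I.
        curvature G s = \<bar>torsion F s * sin (\<theta> s)\<bar> \<and>
        torsion G s = torsion F s * cos (\<theta> s) \<and>
        curvature F s = \<bar>(curvature G s)\<^sup>2 / ((curvature G s)\<^sup>2 + (torsion G s)\<^sup>2) *
                          deriv (\<lambda>r. torsion G r / curvature G r) s\<bar> \<and>
        \<bar>torsion F s\<bar> = sqrt ((curvature G s)\<^sup>2 + (torsion G s)\<^sup>2)))"
proof -
  note F = assms(4)
  from assms(6) have G: "frenet_curve I \<beta> G" and M: "mannheim_curve_of I F G"
    and GX: "\<forall>s\<in>I. tangent G s = X s"
    by (auto simp: mannheim_direction_curve_def direction_curve_def)
  note angle = mannheim_direction_angle[OF assms(1) F G M assms(5)]
  note MX = assms(6)[unfolded mannheim_direction_curve_def]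
  have cosh_sinh: "(cosh x)\<^sup>2 - (sinh x)\<^sup>2 = 1" for x :: real
    by (simp add: cosh_square_eq)
  have sin_cos: "(sin x)\<^sup>2 + (cos x)\<^sup>2 = 1" for x :: real
    by simp
  have D: "(sinh has_real_derivative cosh x) (at x)" "(sin has_real_derivative cos x) (at x)"
      "((\<lambda>x. - cosh x) has_real_derivative - sinh x) (at x)"
      "((\<lambda>x. - cos x) has_real_derivative sin x) (at x)" for x :: real
    by (auto intro!: derivative_eq_intros)
  have W: "\<bar>- sinh x * sinh x - - cosh x * cosh x\<bar> = 1"
      "\<bar>cosh x * - cosh x - sinh x * - sinh x\<bar> = 1"
      "\<bar>sin x * sin x - - cos x * cos x\<bar> = 1" for x :: real
    using cosh_sinh[of x] sin_cos[of x] by (simp_all add: power2_eq_square)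
  \<comment> \<open>The two derivative facts fix \<open>p\<close> and \<open>q\<close>: the pairs
    (-cosh, sinh), (sinh, -cosh) and (-cos, sin), one for each shape of \<open>X\<close>.\<close>
  note angle_cosh = angle[OF _ _ _ D(3) D(1) W(1)]
    and angle_sinh = angle[OF _ _ _ D(1) D(3) W(2)]
    and angle_cos = angle[OF _ _ _ D(4) D(2) W(3)]
  have case1:
    "curvature G s = \<bar>torsion F s * sinh (\<theta> s)\<bar> \<and> torsion G s = - torsion F s * cosh (\<theta> s) \<and>
      curvature F s = \<bar>(curvature G s)\<^sup>2 / ((torsion G s)\<^sup>2 - (curvature G s)\<^sup>2) *
        deriv (\<lambda>r. torsion G r / curvature G r) s\<bar> \<and>
      \<bar>torsion F s\<bar> = sqrt ((torsion G s)\<^sup>2 - (curvature G s)\<^sup>2)"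
    if "timelike_curve I \<alpha>" "timelike_field I X" and s: "s \<in> I" for s
  proof -
    have X: "\<forall>r\<in>I. tangent G r = - cosh (\<theta> r) *\<^sub>R tangent F r + sinh (\<theta> r) *\<^sub>R normal F r"
      using MX GX that by auto
    have e: "\<forall>r\<in>I. sign_T F r = -1"
      using timelike_curve_sign_T[OF F] that by (auto simp: spacelike_type1_def spacelike_type2_def)
    note C = angle_cosh[OF _ e X s, simplified]
    \<comment> \<open>This identity does double duty: it supplies the premise on \<open>D\<close> in
      \<open>C(3)\<close>, and its square root is the last formula.\<close>
    have "(torsion G s)\<^sup>2 - (curvature G s)\<^sup>2 = (torsion F s)\<^sup>2 * ((cosh (\<theta> s))\<^sup>2 - (sinh (\<theta> s))\<^sup>2)"
      unfolding C(1,2) by (simp only: power2_abs power_mult_distrib power2_minus) algebra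
    then show ?thesis
      using C by (simp add: cosh_sinh)
  qed
  have case2:
    "curvature G s = \<bar>torsion F s * sinh (\<theta> s)\<bar> \<and> torsion G s = torsion F s * cosh (\<theta> s) \<and>
      curvature F s = \<bar>(curvature G s)\<^sup>2 / ((torsion G s)\<^sup>2 - (curvature G s)\<^sup>2) *
        deriv (\<lambda>r. torsion G r / curvature G r) s\<bar> \<and>
      \<bar>torsion F s\<bar> = sqrt ((torsion G s)\<^sup>2 - (curvature G s)\<^sup>2)"
    if "spacelike_type1 I \<alpha> F" "spacelike_field I X" and s: "s \<in> I" for s
  proof -
    have X: "\<forall>r\<in>I. tangent G r = - cosh (\<theta> r) *\<^sub>R tangent F r + sinh (\<theta> r) *\<^sub>R normal F r"
      using MX GX that by auto
    have e: "\<forall>r\<in>I. sign_T F r = 1"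
      using spacelike_tangent_sign_T[OF F] that by (auto simp: spacelike_type1_def spacelike_type2_def)
    note C = angle_cosh[OF _ e X s, simplified]
    have "(torsion G s)\<^sup>2 - (curvature G s)\<^sup>2 = (torsion F s)\<^sup>2 * ((cosh (\<theta> s))\<^sup>2 - (sinh (\<theta> s))\<^sup>2)"
      unfolding C(1,2) by (simp only: power2_abs power_mult_distrib power2_minus) algebra
    then show ?thesis
      using C by (simp add: cosh_sinh)
  qed
  have case3:
    "curvature G s = \<bar>torsion F s * cosh (\<theta> s)\<bar> \<and> torsion G s = torsion F s * sinh (\<theta> s) \<and>
      curvature F s = \<bar>(curvature G s)\<^sup>2 / ((curvature G s)\<^sup>2 - (torsion G s)\<^sup>2) *
        deriv (\<lambda>r. torsion G r / curvature G r) s\<bar> \<and>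
      \<bar>torsion F s\<bar> = sqrt ((curvature G s)\<^sup>2 - (torsion G s)\<^sup>2)"
    if "timelike_curve I \<alpha>" "spacelike_field I X" and s: "s \<in> I" for s
  proof -
    have X: "\<forall>r\<in>I. tangent G r = sinh (\<theta> r) *\<^sub>R tangent F r + - cosh (\<theta> r) *\<^sub>R normal F r"
      using MX GX that by auto
    have e: "\<forall>r\<in>I. sign_T F r = -1"
      using timelike_curve_sign_T[OF F] that by (auto simp: spacelike_type1_def spacelike_type2_def)
    note C = angle_sinh[OF _ e X s, simplified]
    \<comment> \<open>The difference is reversed because the curvature now carries cosh and the
      torsion sinh.\<close>
    have "(curvature G s)\<^sup>2 - (torsion G s)\<^sup>2 = (torsion F s)\<^sup>2 * ((cosh (\<theta> s))\<^sup>2 - (sinh (\<theta> s))\<^sup>2)"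
      unfolding C(1,2) by (simp only: power2_abs power_mult_distrib power2_minus) algebra
    then show ?thesis
      using C by (simp add: cosh_sinh)
  qed
  have case4:
    "curvature G s = \<bar>torsion F s * cosh (\<theta> s)\<bar> \<and> torsion G s = - torsion F s * sinh (\<theta> s) \<and>
      curvature F s = \<bar>(curvature G s)\<^sup>2 / ((curvature G s)\<^sup>2 - (torsion G s)\<^sup>2) *
        deriv (\<lambda>r. torsion G r / curvature G r) s\<bar> \<and>
      \<bar>torsion F s\<bar> = sqrt ((curvature G s)\<^sup>2 - (torsion G s)\<^sup>2)"
    if "spacelike_type1 I \<alpha> F" "timelike_field I X" and s: "s \<in> I" for s
  proof -
    have X: "\<forall>r\<in>I. tangent G r = sinh (\<theta> r) *\<^sub>R tangent F r + - cosh (\<theta> r) *\<^sub>R normal F r"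
      using MX GX that by auto
    have e: "\<forall>r\<in>I. sign_T F r = 1"
      using spacelike_tangent_sign_T[OF F] that by (auto simp: spacelike_type1_def spacelike_type2_def)
    note C = angle_sinh[OF _ e X s, simplified]
    have "(curvature G s)\<^sup>2 - (torsion G s)\<^sup>2 = (torsion F s)\<^sup>2 * ((cosh (\<theta> s))\<^sup>2 - (sinh (\<theta> s))\<^sup>2)"
      unfolding C(1,2) by (simp only: power2_abs power_mult_distrib power2_minus) algebra
    then show ?thesis
      using C by (simp add: cosh_sinh)
  qed
  have case5:
    "curvature G s = \<bar>torsion F s * sin (\<theta> s)\<bar> \<and> torsion G s = torsion F s * cos (\<theta> s) \<and>
      curvature F s = \<bar>(curvature G s)\<^sup>2 / ((curvature G s)\<^sup>2 + (torsion G s)\<^sup>2) *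
        deriv (\<lambda>r. torsion G r / curvature G r) s\<bar> \<and>
      \<bar>torsion F s\<bar> = sqrt ((curvature G s)\<^sup>2 + (torsion G s)\<^sup>2)"
    if "spacelike_type2 I \<alpha> F" "spacelike_field I X" and s: "s \<in> I" for s
  proof -
    have X: "\<forall>r\<in>I. tangent G r = - cos (\<theta> r) *\<^sub>R tangent F r + sin (\<theta> r) *\<^sub>R normal F r"
      using MX GX that by auto
    have e: "\<forall>r\<in>I. sign_T F r = 1"
      using spacelike_tangent_sign_T[OF F] that by (auto simp: spacelike_type1_def spacelike_type2_def)
    note C = angle_cos[OF _ e X s, simplified]
    have "(curvature G s)\<^sup>2 + (torsion G s)\<^sup>2 = (torsion F s)\<^sup>2 * ((sin (\<theta> s))\<^sup>2 + (cos (\<theta> s))\<^sup>2)"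
      unfolding C(1,2) by (simp only: power2_abs power_mult_distrib power2_minus) algebra
    then show ?thesis
      using C by (simp add: sin_cos)
  qed
  show ?thesis
    using case1 case2 case3 case4 case5 by blast
qed

end
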